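(* Let $s\ge k_1\ge2$ and $\Gamma=\Gamma_{k_1,k_1,s}=\Gamma_{k_1,k_1}\cup\{12\cdots s(s+1)\}$. Then $U_{\Gamma,1}(y)=-y$ and for $n\ge2$ $$U_{\Gamma,n}(y)=-y\sum_{r=1}^{k_1-1}U_{\Gamma,n-r}(y)-y\sum_{p=0}^{s-k_1}\left[\left(1+\binom{n-p-2}{k_1-1}\right)U_{\Gamma,n-p-k_1}(y)+y\binom{n-p-2}{k_1-1}\sum_{a=1}^{k_1-1}U_{\Gamma,n-p-k_1-a}(y)\right].$$
   Context: $\Gamma_{k_1,k_2}=\{\sigma\in\mathfrak S_{k_1+k_2}:\sigma_1=1,\ \sigma_{k_1+1}=2,\ \sigma_1<\cdots<\sigma_{k_1},\ \sigma_{k_1+1}<\cdots<\sigma_{k_1+k_2}\}$, and $12\cdots s(s+1)$ is the identity of $\mathfrak S_{s+1}$. For $\sigma\in\mathfrak S_n$, $\mathrm{des}(\sigma)$ is the number of $i$ with $\sigma_i>\sigma_{i+1}$. For distinct integers $\alpha=\alpha_1\cdots\alpha_r$, $\mathrm{red}(\alpha)\in\mathfrak S_r$ replaces the $i$-th smallest entry by $i$. $\sigma$ has a $\Gamma$-match starting at position $i$ if there is $j\ge1$ with $\mathrm{red}(\sigma_i\cdots\sigma_{i+j})\in\Gamma$; $\mathcal{NM}_n(\Gamma)$ is the set of $\sigma\in\mathfrak S_n$ with no $\Gamma$-match. The polynomials $U_{\Gamma,n}(y)$ are defined by $\sum_{n\ge0}U_{\Gamma,n}(y)\frac{t^n}{n!}=\left(1+\sum_{n\ge1}\frac{t^n}{n!}\sum_{\sigma\in\mathcal{NM}_n(\Gamma)}y^{1+\mathrm{des}(\sigma)}\right)^{-1}$;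 in particular $U_{\Gamma,0}=1$, and $U_{\Gamma,j}=0$ for $j<0$. Binomial coefficients $\binom{a}{b}$ are $0$ when $a<b$. *)

theory Defs
  imports
    "HOL-Combinatorics.Multiset_Permutations"
    "HOL-Computational_Algebra.Formal_Power_Series"
    "HOL-Computational_Algebra.Polynomial"
begin

text \<open>
  Permutations are lists in one-line notation: the symmetric group on \<open>n\<close> letters is
  \<open>permutations_of_set {1..n}\<close>, and the entry \<open>\<sigma>\<^sub>i\<close> is \<open>\<sigma> ! (i - 1)\<close>.
\<close>

definition des :: "nat list \<Rightarrow> nat" where
  "des \<sigma> = card {i. Suc i < length \<sigma> \<and> \<sigma> ! i > \<sigma> ! Suc i}"

definition red :: "nat list \<Rightarrow> nat list" where
  "red \<alpha> = map (\<lambda>x. card {y \<in> set \<alpha>. y \<le> x}) \<alpha>"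

text \<open>Here \<open>i\<close> counts from 0, and the window consists of the \<open>j + 1\<close> entries from there on.\<close>

definition match_at :: "nat list set \<Rightarrow> nat list \<Rightarrow> nat \<Rightarrow> bool" where
  "match_at \<Gamma> \<sigma> i \<longleftrightarrow>
     (\<exists>j\<ge>1. i + j < length \<sigma> \<and> red (take (j + 1) (drop i \<sigma>)) \<in> \<Gamma>)"

definition NM :: "nat list set \<Rightarrow> nat \<Rightarrow> nat list set" where
  "NM \<Gamma> n = {\<sigma> \<in> permutations_of_set {1..n}. \<not> (\<exists>i. match_at \<Gamma> \<sigma> i)}"

definition Gamma2 :: "nat \<Rightarrow> nat \<Rightarrow> nat list set" where
  "Gamma2 k1 k2 = {\<sigma> \<in> permutations_of_set {1..k1 + k2}.
     \<sigma> ! 0 = 1 \<and> \<sigma> ! k1 = 2 \<and> sorted_wrt (<) (take k1 \<sigma>) \<and> sorted_wrt (<) (drop k1 \<sigma>)}"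

definition Gamma3 :: "nat \<Rightarrow> nat \<Rightarrow> nat \<Rightarrow> nat list set" where
  "Gamma3 k1 k2 s = Gamma2 k1 k2 \<union> {[1..<s + 2]}"

abbreviation yvar :: "rat poly" where
  "yvar \<equiv> monom 1 1"

definition NM_egf :: "nat list set \<Rightarrow> rat poly fps" where
  "NM_egf \<Gamma> = Abs_fps (\<lambda>n. if n = 0 then 1
     else smult (1 / fact n) (\<Sum>\<sigma>\<in>NM \<Gamma> n. yvar ^ (1 + des \<sigma>)))"

text \<open>
  The coefficient ring \<open>rat poly\<close> is not a field, so the generic \<open>inverse\<close> on power series is
  unavailable; \<open>fps_right_inverse F 1\<close> is the inverse of a series \<open>F\<close> with constant term 1.
\<close>

definition U :: "nat list set \<Rightarrow> int \<Rightarrow> rat poly" where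
  "U \<Gamma> j = (if j < 0 then 0
     else smult (fact (nat j)) (fps_nth (fps_right_inverse (NM_egf \<Gamma>) 1) (nat j)))"

lemma NM_egf_times_U_egf:
  "NM_egf \<Gamma> * Abs_fps (\<lambda>n. smult (1 / fact n) (U \<Gamma> (int n))) = 1"
proof -
  have "Abs_fps (\<lambda>n. smult (1 / fact n) (U \<Gamma> (int n))) = fps_right_inverse (NM_egf \<Gamma>) 1"
    by (rule fps_ext) (simp add: U_def)
  moreover have "fps_nth (NM_egf \<Gamma>) 0 * 1 = 1"
    by (simp add: NM_egf_def)
  ultimately show ?thesis
    using fps_right_inverse by metis
qed

end

theory Submission
  imports Defs "HOL-Library.Infinite_Set"
begin

text \<open>
  The polynomial \<open>U\<^sub>n\<close> is a signed count of tilings: write a permutation as a sequence of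
  increasing bricks of length at most \<open>s\<close>, each weighted by \<open>- y\<close>, such that the entries
  increase from one brick to the next or else the two bricks contain a \<open>\<Gamma>\<^bsub>k,k\<^esub>\<close>-match
  around their common boundary. To see this, consider pairs of a \<open>\<Gamma>\<close>-avoiding word \<open>\<alpha>\<close>
  followed by such a tiling. Moving the last increasing run of \<open>\<alpha>\<close> to the front of the tiling,
  or the first brick to the end of \<open>\<alpha>\<close>, is a sign-reversing involution on these pairs; hence the
  exponential generating function of the tilings is the inverse of the one of the avoiders.

  The first entries of the bricks increase, so the smallest entry of a tiling comes first. If
  the first brick is followed by an ascent, it is \<open>1 2 \<dots> r\<close>, which gives the terms
  \<open>- y U\<^bsub>n-r\<^esub>\<close>. Otherwise it has length \<open>p + k\<close>, starts with \<open>1 2 \<dots> (p+1)\<close> and is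
  followed by a brick of length at least \<open>k\<close> starting with \<open>p + 2\<close>. Tilings whose first brick
  is shorter than \<open>k\<close> have an ascent after it, so removing them from \<open>U\<^sub>m\<close> leaves
  \<open>U\<^sub>m + y (U\<^bsub>m-1\<^esub> + \<dots> + U\<^bsub>m-k+1\<^esub>)\<close>.
\<close>

section \<open>Increasing lists and last increasing runs\<close>

abbreviation incr :: "nat list \<Rightarrow> bool" where
  "incr \<equiv> sorted_wrt (<)"

lemma incr_distinct: "incr xs \<Longrightarrow> distinct xs"
  using strict_sorted_iff by blast

lemma incr_hd_le: "incr xs \<Longrightarrow> x \<in> set xs \<Longrightarrow> hd xs \<le> x"
  by (cases xs) auto

lemma incr_le_last: "incr xs \<Longrightarrow> x \<in> set xs \<Longrightarrow> x \<le> last xs"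
  by (induction xs) (auto dest: last_in_set intro: less_imp_le)

lemma incr_append_last_less_hd:
  "incr (xs @ ys) \<Longrightarrow> xs \<noteq> [] \<Longrightarrow> ys \<noteq> [] \<Longrightarrow> last xs < hd ys"
  by (auto simp: sorted_wrt_append)

lemma incr_eq_of_set_eq: "incr xs \<Longrightarrow> incr ys \<Longrightarrow> set xs = set ys \<Longrightarrow> xs = ys"
  by (metis sorted_distinct_set_unique strict_sorted_iff)

text \<open>The descent before \<open>R\<close> makes \<open>R\<close> a maximal run. An entry put
  in front joins \<open>R\<close> only if nothing else precedes \<open>R\<close> and the entry is
  smaller than \<open>hd R\<close>.\<close>

lemma exists_last_run:
  "xs \<noteq> [] \<Longrightarrow> distinct xs \<Longrightarrow>
     \<exists>as R. xs = as @ R \<and> R \<noteq> [] \<and> incr R \<and> (as = [] \<or> last as > hd R)"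
proof (induction xs rule: list_nonempty_induct)
  case (single x)
  then show ?case
    by (intro exI[of _ "[]"] exI[of _ "[x]"]) simp
next
  case (cons x xs)
  then obtain as R where R: "xs = as @ R" "R \<noteq> []" "incr R" "as = [] \<or> last as > hd R"
    by auto
  show ?case
  proof (cases "as = [] \<and> x < hd R")
    case True
    have "incr (x # R)"
      using True R incr_hd_le by fastforce
    then show ?thesis
      using True R by (intro exI[of _ "[]"] exI[of _ "x # R"]) simp
  next
    case False
    then show ?thesis
      using R cons.prems by (intro exI[of _ "x # as"] exI[of _ R]) (cases R, auto)
  qed
qed

text \<open>If the two cuts differed, the piece between them would lie in the longer run, and the
  shorter run would be preceded by an ascent instead of a descent.\<close>

lemma last_run_unique:
  assumes "as @ R = bs @ Q" "R \<noteq> []" "Q \<noteq> []" "incr R" "incr Q"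
    "as = [] \<or> last as > hd R" "bs = [] \<or> last bs > hd Q"
  shows "as = bs \<and> R = Q"
proof -
  have *: "u = []"
    if "R' = u @ Q'" "as' @ u = bs'" "incr R'" "Q' \<noteq> []" "bs' = [] \<or> last bs' > hd Q'"
    for R' Q' u as' bs' :: "nat list"
  proof (rule ccontr)
    assume u: "u \<noteq> []"
    then have "last u < hd Q'"
      using that incr_append_last_less_hd by blast
    then show False
      using that u by (auto simp: last_append split: if_splits)
  qed
  from assms(1) obtain u where "as = bs @ u \<and> u @ R = Q \<or> as @ u = bs \<and> R = u @ Q"
    by (auto simp: append_eq_append_conv2)
  then show ?thesis
  proof
    assume u: "as = bs @ u \<and> u @ R = Q"
    then have "u = []"
      using *[of Q u R bs as] assms by metis
    then show ?thesis using u by simp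
  next
    assume u: "as @ u = bs \<and> R = u @ Q"
    then have "u = []"
      using *[of R u Q as bs] assms by metis
    then show ?thesis using u by simp
  qed
qed

section \<open>Descents, order isomorphisms and sums over subsets\<close>

lemma des_Nil [simp]: "des [] = 0"
  by (simp add: des_def)

lemma des_Cons: "des (x # ys) = (if ys \<noteq> [] \<and> x > hd ys then 1 else 0) + des ys"
proof -
  let ?D = "\<lambda>zs. {i. Suc i < length zs \<and> zs ! i > zs ! Suc i}"
  have finite_D: "finite (?D ys)"
    by (rule finite_subset[of _ "{..<length ys}"]) auto
  have "?D (x # ys) = (if ys \<noteq> [] \<and> x > hd ys then {0} else {}) \<union> Suc ` ?D ys"
    (is "_ = ?E \<union> _")
  proof (intro set_eqI)
    fix i
    show "i \<in> ?D (x # ys) \<longleftrightarrow> i \<in> ?E \<union> Suc ` ?D ys"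
      by (cases i) (auto simp: hd_conv_nth)
  qed
  moreover have "card (?E \<union> Suc ` ?D ys) = card ?E + card (Suc ` ?D ys)"
    by (intro card_Un_disjoint) (auto simp: finite_D)
  ultimately show ?thesis
    by (simp add: des_def card_image)
qed

lemma des_append:
  "des (xs @ ys) =
     des xs + des ys + (if xs \<noteq> [] \<and> ys \<noteq> [] \<and> last xs > hd ys then 1 else 0)"
  by (induction xs) (auto simp: des_Cons)

lemma des_incr: "incr xs \<Longrightarrow> des xs = 0"
  by (induction xs) (auto simp: des_Cons dest!: hd_in_set)

lemma des_map:
  assumes "strict_mono_on T h" "set xs \<subseteq> T"
  shows "des (map h xs) = des xs"
proof -
  have "h (xs ! i) > h (xs ! Suc i) \<longleftrightarrow> xs ! i > xs ! Suc i" if "Suc i < length xs" for i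
    using assms that by (intro strict_mono_on_less) auto
  then show ?thesis
    unfolding des_def by (intro arg_cong[where f = card]) auto
qed

lemma incr_map_iff:
  assumes "strict_mono_on T h" "set xs \<subseteq> T"
  shows "incr (map h xs) \<longleftrightarrow> incr xs"
  using assms
proof (induction xs)
  case (Cons x xs)
  then show ?case
    using strict_mono_on_less[OF Cons.prems(1)] by auto
qed simp

text \<open>The i-th smallest element of \<open>S\<close> goes to the i-th smallest of
  \<open>T\<close>. Both maps come with their inverse laws because they serve as the two witnesses
  of a bijection between labelled objects on \<open>S\<close> and on \<open>T\<close>.\<close>

lemma exists_order_iso:
  fixes S T :: "nat set"
  assumes "finite S" "finite T" "card S = card T"
  obtains h g where "strict_mono_on S h" "h ` S = T" "strict_mono_on T g" "g ` T = S"
    "\<And>x. x \<in> S \<Longrightarrow> g (h x) = x" "\<And>y. y \<in> T \<Longrightarrow> h (g y) = y"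
proof -
  have inv_mono: "strict_mono_on (h ` S) (inv_into S h)"
    if "strict_mono_on S h" for h :: "nat \<Rightarrow> nat" and S
    using that by (auto intro!: strict_mono_onI
        simp: strict_mono_on_imp_inj_on strict_mono_on_less)
  obtain a where a: "bij_betw a {..<card S} S" "strict_mono_on {..<card S} a"
    using ex_bij_betw_strict_mono_card[OF assms(1)] .
  obtain b where b: "bij_betw b {..<card T} T" "strict_mono_on {..<card T} b"
    using ex_bij_betw_strict_mono_card[OF assms(2)] .
  define h where "h = b \<circ> inv_into {..<card S} a"
  have a': "bij_betw (inv_into {..<card S} a) S {..<card S}"
    using a(1) by (rule bij_betw_inv_into)
  have h: "bij_betw h S T"
    unfolding h_def using a' b(1) assms(3) by (auto intro: bij_betw_trans)
  have "strict_mono_on S h"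
  proof (rule strict_mono_onI)
    fix x y assume xy: "x \<in> S" "y \<in> S" "x < y"
    have "inv_into {..<card S} a x < inv_into {..<card S} a y"
      using strict_mono_onD[OF inv_mono[OF a(2)]] xy a(1) by (auto simp: bij_betw_def)
    then show "h x < h y"
      using xy a' assms(3) strict_mono_onD[OF b(2)] bij_betwE[OF a'] by (auto simp: h_def)
  qed
  moreover have "strict_mono_on T (inv_into S h)"
    using inv_mono[OF \<open>strict_mono_on S h\<close>] h by (simp add: bij_betw_def)
  ultimately show thesis
    using h that[of h "inv_into S h"]
    by (auto simp: bij_betw_def bij_betw_inv_into_left f_inv_into_f)
qed

lemma sum_Pow_card:
  fixes F :: "nat \<Rightarrow> 'a :: comm_semiring_1"
  assumes "finite S"
  shows "(\<Sum>T\<in>Pow S. F (card T)) = (\<Sum>i\<le>card S. of_nat (card S choose i) * F i)"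
proof -
  have "(\<Sum>T\<in>Pow S. F (card T)) = (\<Sum>i\<le>card S. \<Sum>T\<in>{T \<in> Pow S. card T = i}. F (card T))"
    using assms by (intro sum.group[symmetric]) (auto intro: card_mono)
  also have "\<dots> = (\<Sum>i\<le>card S. of_nat (card S choose i) * F i)"
    using assms by (intro sum.cong) (simp_all add: n_subsets)
  finally show ?thesis .
qed

lemma smult_sum_distrib: "smult c (\<Sum>i\<in>I. f i) = (\<Sum>i\<in>I. smult c (f i))"
  by (induction I rule: infinite_finite_induct) (simp_all add: smult_add_right)

section \<open>Matches expressed by comparisons of entries\<close>

text \<open>Here \<open>k\<close> is the \<open>k\<^sub>1\<close> of the theorem.\<close>

locale brick_params =
  fixes k s :: nat
  assumes k_ge_2: "2 \<le> k" and k_le_s: "k \<le> s"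
begin

text \<open>
  \<open>w1 @ w2\<close> reduces to an element of \<open>\<Gamma>\<^bsub>k,k\<^esub>\<close>: since both halves increase, the
  conditions \<open>\<sigma>\<^sub>1 = 1\<close> and \<open>\<sigma>\<^bsub>k+1\<^esub> = 2\<close> only concern the first entries.
\<close>

definition matched :: "nat list \<Rightarrow> nat list \<Rightarrow> bool" where
  "matched w1 w2 \<longleftrightarrow> length w1 = k \<and> length w2 = k \<and> incr w1 \<and> incr w2 \<and>
     w1 ! 0 < w2 ! 0 \<and> w2 ! 0 < w1 ! 1"

text \<open>Membership of the reduced word in \<open>Gamma3 k k s\<close>, without the reduction;
  see \<open>red_in_Gamma3_iff\<close>.\<close>

definition pat :: "nat list \<Rightarrow> bool" where
  "pat w \<longleftrightarrow> length w = s + 1 \<and> incr w \<or> (\<exists>w1 w2. w = w1 @ w2 \<and> matched w1 w2)"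

definition avoids :: "nat list \<Rightarrow> bool" where
  "avoids xs \<longleftrightarrow> (\<forall>u w v. xs = u @ w @ v \<longrightarrow> \<not> pat w)"

text \<open>The rank map \<open>r\<close> increases strictly from the entries onto
  \<open>{1..length w}\<close>, so \<open>red w\<close> is a permutation with the same comparisons
  as \<open>w\<close>. Only the prescribed values 1 and 2 need translation.\<close>

lemma red_in_Gamma3_iff:
  assumes "distinct w"
  shows "red w \<in> Gamma3 k k s \<longleftrightarrow> pat w"
proof -
  define r where "r x = card {y \<in> set w. y \<le> x}" for x
  have red: "red w = map r w"
    by (simp add: red_def r_def)
  have mono: "strict_mono_on (set w) r"
  proof (rule strict_mono_onI)
    fix x y assume "x \<in> set w" "y \<in> set w" "x < y"
    then have "{z \<in> set w. z \<le> x} \<subset> {z \<in> set w. z \<le> y}"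
      by (auto simp: psubset_eq set_eq_iff intro: exI[of _ y])
    then show "r x < r y"
      unfolding r_def by (intro psubset_card_mono) auto
  qed
  have r_range: "r ` set w = {1..length w}"
  proof (rule card_subset_eq)
    show "r ` set w \<subseteq> {1..length w}"
    proof safe
      fix x assume "x \<in> set w"
      then have "{y \<in> set w. y \<le> x} \<noteq> {}" by auto
      then have "r x \<noteq> 0" by (simp add: r_def)
      moreover have "r x \<le> card (set w)"
        unfolding r_def by (intro card_mono) auto
      ultimately show "r x \<in> {1..length w}"
        using assms by (simp add: distinct_card)
    qed
    show "card (r ` set w) = card {1..length w}"
      using assms mono by (simp add: card_image strict_mono_on_imp_inj_on distinct_card)
  qed simp
  have perm: "red w \<in> permutations_of_set {1..m} \<longleftrightarrow> length w = m" for m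
    using r_range mono assms
    by (auto simp: red permutations_of_set_def distinct_map strict_mono_on_imp_inj_on)
  have incr: "incr (map r v) \<longleftrightarrow> incr v" if "set v \<subseteq> set w" for v
    using incr_map_iff[OF mono that] .
  have id: "red w = [1..<s + 2] \<longleftrightarrow> length w = s + 1 \<and> incr w"
  proof
    assume eq: "red w = [1..<s + 2]"
    then have "length (map r w) = s + 1" "incr (map r w)"
      unfolding red by (simp_all del: upt_Suc)
    then show "length w = s + 1 \<and> incr w"
      using incr[of w] by simp
  next
    assume w: "length w = s + 1 \<and> incr w"
    then have "incr (red w)" "set (red w) = {1..s + 1}"
      using incr[of w] r_range by (simp_all add: red)
    then show "red w = [1..<s + 2]"
      by (intro incr_eq_of_set_eq) (simp_all del: upt_Suc add: atLeastLessThanSuc_atLeastAtMost)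
  qed
  have "red w \<in> Gamma2 k k \<longleftrightarrow>
    length w = k + k \<and> incr (take k w) \<and> incr (drop k w) \<and> w ! 0 < w ! k \<and> w ! k < w ! 1"
    (is "_ \<longleftrightarrow> ?R")
  proof (cases "length w = k + k \<and> incr (take k w) \<and> incr (drop k w)")
    case True
    then have len: "length w = k + k" and inc: "incr (take k w)" "incr (drop k w)"
      by auto
    have r_nth: "red w ! i = r (w ! i)" if "i < length w" for i
      using that by (simp add: red)
    have in_w: "w ! 0 \<in> set w" "w ! 1 \<in> set w" "w ! k \<in> set w"
      using k_ge_2 len by auto
    have lt01: "w ! 0 < w ! 1"
      using inc(1) k_ge_2 len sorted_wrt_nth_less[OF inc(1), of 0 1] by simp
    \<comment> \<open>Lower bounds for all entries other than \<open>w ! 0\<close> and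
      \<open>w ! k\<close>; they determine the sets counted by \<open>r (w ! 0)\<close> and
      \<open>r (w ! k)\<close>.\<close>
    have cases_w: "x = w ! 0 \<or> w ! 1 \<le> x \<or> x = w ! k \<or> w ! k < x" if x: "x \<in> set w" for x
    proof -
      obtain i where i: "i < length w" "x = w ! i"
        using x by (metis in_set_conv_nth)
      consider "i = 0" | "1 = i" | "1 < i" "i < k" | "i = k" | "k < i" by linarith
      then show ?thesis
      proof cases
        case 3
        then show ?thesis
          using sorted_wrt_nth_less[OF inc(1), of 1 i] i len by auto
      next
        case 5
        then show ?thesis
          using sorted_wrt_nth_less[OF inc(2), of 0 "i - k"] i len by auto
      qed (use i in auto)
    qed
    have "r (w ! 0) = 1 \<and> r (w ! k) = 2 \<longleftrightarrow> w ! 0 < w ! k \<and> w ! k < w ! 1"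
    proof
      assume A: "r (w ! 0) = 1 \<and> r (w ! k) = 2"
      then have l: "w ! 0 < w ! k"
        using strict_mono_on_less[OF mono in_w(1) in_w(3)] by simp
      have "w ! 1 \<noteq> w ! k"
        using assms len k_ge_2 by (simp add: nth_eq_iff_index_eq)
      moreover have "\<not> w ! 1 < w ! k"
      proof
        assume "w ! 1 < w ! k"
        then have "r (w ! 1) < r (w ! k)"
          using strict_mono_on_less[OF mono in_w(2) in_w(3)] by simp
        moreover have "r (w ! 0) < r (w ! 1)"
          using strict_mono_on_less[OF mono in_w(1) in_w(2)] lt01 by simp
        ultimately show False using A by simp
      qed
      ultimately show "w ! 0 < w ! k \<and> w ! k < w ! 1"
        using l by simp
    next
      assume A: "w ! 0 < w ! k \<and> w ! k < w ! 1"
      have "{y \<in> set w. y \<le> w ! 0} = {w ! 0}" "{y \<in> set w. y \<le> w ! k} = {w ! 0, w ! k}"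
        using A in_w cases_w lt01 by fastforce+
      then show "r (w ! 0) = 1 \<and> r (w ! k) = 2"
        using A by (simp add: r_def)
    qed
    moreover have "incr (take k (red w))" "incr (drop k (red w))"
      using incr[of "take k w"] incr[of "drop k w"] inc
      by (auto simp: red take_map drop_map set_take_subset set_drop_subset)
    moreover have "0 < length w" "k < length w"
      using len k_ge_2 by auto
    ultimately show ?thesis
      using True perm[of "k + k"] r_nth by (simp add: Gamma2_def)
  next
    case False
    then show ?thesis
      using incr[of "take k w"] incr[of "drop k w"] perm[of "k + k"]
      by (auto simp: Gamma2_def red take_map drop_map set_take_subset set_drop_subset)
  qed
  also have "?R \<longleftrightarrow> (\<exists>w1 w2. w = w1 @ w2 \<and> matched w1 w2)"
  proof
    assume ?R
    then show "\<exists>w1 w2. w = w1 @ w2 \<and> matched w1 w2"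
      using k_ge_2 by (intro exI[of _ "take k w"] exI[of _ "drop k w"]) (auto simp: matched_def)
  qed (use k_ge_2 in \<open>auto simp: matched_def nth_append\<close>)
  finally show ?thesis
    using id by (auto simp: Gamma3_def pat_def)
qed

lemma NM_Gamma3_eq: "NM (Gamma3 k k s) n = {\<sigma> \<in> permutations_of_set {1..n}. avoids \<sigma>}"
proof -
  have "(\<exists>i. match_at (Gamma3 k k s) \<sigma> i) \<longleftrightarrow> \<not> avoids \<sigma>" if "distinct \<sigma>" for \<sigma>
  proof
    assume "\<exists>i. match_at (Gamma3 k k s) \<sigma> i"
    then obtain i j where "red (take (j + 1) (drop i \<sigma>)) \<in> Gamma3 k k s"
      unfolding match_at_def by blast
    then have "pat (take (j + 1) (drop i \<sigma>))"
      using red_in_Gamma3_iff that by simp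
    moreover have "\<sigma> = take i \<sigma> @ take (j + 1) (drop i \<sigma>) @ drop (j + 1) (drop i \<sigma>)"
      by (metis append_take_drop_id)
    ultimately show "\<not> avoids \<sigma>"
      unfolding avoids_def by metis
  next
    assume "\<not> avoids \<sigma>"
    then obtain u w v where \<sigma>: "\<sigma> = u @ w @ v" and w: "pat w"
      unfolding avoids_def by blast
    \<comment> \<open>\<open>match_at\<close> only looks at windows of two or more entries; patterns
      have \<open>s + 1\<close> or \<open>2 * k\<close> entries, so none is missed.\<close>
    have "length w \<ge> 2"
      using w k_ge_2 k_le_s by (auto simp: pat_def matched_def)
    moreover have "red w \<in> Gamma3 k k s"
      using w \<sigma> that red_in_Gamma3_iff[of w] by simp
    ultimately show "\<exists>i. match_at (Gamma3 k k s) \<sigma> i"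
      unfolding match_at_def \<sigma>
      by (intro exI[of _ "length u"] exI[of _ "length w - 1"] conjI) auto
  qed
  then show ?thesis
    by (auto simp: NM_def permutations_of_set_def)
qed

lemma matched_map_iff:
  assumes "strict_mono_on T h" "set w1 \<subseteq> T" "set w2 \<subseteq> T"
  shows "matched (map h w1) (map h w2) \<longleftrightarrow> matched w1 w2"
proof (cases "length w1 = k \<and> length w2 = k")
  case True
  then have "0 < length w1" "1 < length w1" "0 < length w2"
    using k_ge_2 by auto
  moreover then have "w1 ! 0 \<in> T" "w1 ! 1 \<in> T" "w2 ! 0 \<in> T"
    using assms nth_mem by blast+
  ultimately show ?thesis
    using assms True incr_map_iff[OF assms(1)] strict_mono_on_less[OF assms(1)]
    by (simp add: matched_def)
qed (auto simp: matched_def)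

lemma pat_map_iff:
  assumes "strict_mono_on T h" "set w \<subseteq> T"
  shows "pat (map h w) \<longleftrightarrow> pat w"
proof -
  have "(\<exists>w1 w2. map h w = w1 @ w2 \<and> matched w1 w2) \<longleftrightarrow> (\<exists>w1 w2. w = w1 @ w2 \<and> matched w1 w2)"
  proof
    assume "\<exists>w1 w2. map h w = w1 @ w2 \<and> matched w1 w2"
    then obtain v1 v2 where v: "w = v1 @ v2" "matched (map h v1) (map h v2)"
      by (auto simp: map_eq_append_conv)
    then show "\<exists>w1 w2. w = w1 @ w2 \<and> matched w1 w2"
      using assms matched_map_iff[OF assms(1), of v1 v2] by auto
  next
    assume "\<exists>w1 w2. w = w1 @ w2 \<and> matched w1 w2"
    then obtain v1 v2 where v: "w = v1 @ v2" "matched v1 v2"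
      by blast
    then show "\<exists>w1 w2. map h w = w1 @ w2 \<and> matched w1 w2"
      using assms matched_map_iff[OF assms(1), of v1 v2]
      by (intro exI[of _ "map h v1"] exI[of _ "map h v2"]) auto
  qed
  then show ?thesis
    using incr_map_iff[OF assms] by (simp add: pat_def)
qed

lemma avoids_map:
  assumes "strict_mono_on T h" "set xs \<subseteq> T" "avoids xs"
  shows "avoids (map h xs)"
  unfolding avoids_def
proof (intro allI impI)
  fix u w v assume "map h xs = u @ w @ v"
  then obtain u' w' v' where "xs = u' @ w' @ v'" "w = map h w'"
    by (metis map_eq_append_conv)
  then show "\<not> pat w"
    using assms pat_map_iff[OF assms(1), of w'] by (auto simp: avoids_def)
qed

lemma avoids_appendD1: "avoids (xs @ ys) \<Longrightarrow> avoids xs"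
  unfolding avoids_def by fastforce

lemma avoids_appendD2: "avoids (xs @ ys) \<Longrightarrow> avoids ys"
  unfolding avoids_def by (metis append.assoc)

lemma avoids_Nil [simp]: "avoids []"
  using k_ge_2 by (auto simp: avoids_def pat_def matched_def)

text \<open>Inside an increasing word \<open>w2 ! 0 < w1 ! 1\<close> is impossible, so only the
  pattern of length \<open>s + 1\<close> can occur. Hence the length bound in \<open>brick\<close>
  amounts to avoidance.\<close>

lemma avoids_incr_iff:
  assumes "incr xs"
  shows "avoids xs \<longleftrightarrow> length xs \<le> s"
proof
  assume av: "avoids xs"
  show "length xs \<le> s"
  proof (rule ccontr)
    assume "\<not> length xs \<le> s"
    then have "pat (take (s + 1) xs)"
      using assms by (simp add: pat_def sorted_wrt_take)
    then show False
      using av unfolding avoids_def by (metis append_Nil append_take_drop_id)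
  qed
next
  assume len: "length xs \<le> s"
  show "avoids xs"
    unfolding avoids_def
  proof (intro allI impI notI)
    fix u w v assume xs: "xs = u @ w @ v" and "pat w"
    then obtain w1 w2 where w: "w = w1 @ w2" "matched w1 w2"
      using len by (auto simp: pat_def)
    then have "incr (w1 @ w2)" "w1 ! 1 \<in> set w1" "w2 ! 0 \<in> set w2"
      using xs assms k_ge_2 by (auto simp: sorted_wrt_append matched_def)
    then show False
      using w by (fastforce simp: sorted_wrt_append matched_def)
  qed
qed

subsection \<open>Brick tilings\<close>

text \<open>The alternatives exclude each other: \<open>w2 ! 0 < w1 ! 1\<close> puts a descent
  between the bricks.\<close>

definition linked :: "nat list \<Rightarrow> nat list \<Rightarrow> bool" where
  "linked B C \<longleftrightarrow> last B < hd C \<or> (\<exists>z w1 w2 v. B = z @ w1 \<and> C = w2 @ v \<and> matched w1 w2)"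

definition brick :: "nat list \<Rightarrow> bool" where
  "brick B \<longleftrightarrow> B \<noteq> [] \<and> incr B \<and> length B \<le> s"

definition admissible :: "nat list list \<Rightarrow> bool" where
  "admissible Bs \<longleftrightarrow> (\<forall>B\<in>set Bs. brick B) \<and> successively linked Bs"

text \<open>Arbitrary label sets are allowed, since splitting off a word or a first brick leaves
  labels that need not form an initial segment.\<close>

definition tilings :: "nat set \<Rightarrow> nat list list set" where
  "tilings S = {Bs. admissible Bs \<and> distinct (concat Bs) \<and> set (concat Bs) = S}"

definition avoiders :: "nat set \<Rightarrow> nat list set" where
  "avoiders S = {\<sigma> \<in> permutations_of_set S. avoids \<sigma>}"

lemma admissible_Nil [simp]: "admissible []"
  by (simp add: admissible_def)

lemma admissible_Cons:
  "admissible (B # Bs) \<longleftrightarrow> brick B \<and> (Bs \<noteq> [] \<longrightarrow> linked B (hd Bs)) \<and> admissible Bs"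
  by (cases Bs) (auto simp: admissible_def)

section \<open>Relabelling along order isomorphisms\<close>

lemma linked_map:
  assumes "strict_mono_on T h" "set B \<subseteq> T" "set C \<subseteq> T" "B \<noteq> []" "C \<noteq> []" "linked B C"
  shows "linked (map h B) (map h C)"
proof (cases "last B < hd C")
  case True
  then have "h (last B) < h (hd C)"
    using assms strict_mono_onD[OF assms(1)] by (auto simp: subset_iff)
  then show ?thesis
    using assms by (simp add: linked_def last_map hd_map)
next
  case False
  then obtain z w1 w2 v where w: "B = z @ w1" "C = w2 @ v" "matched w1 w2"
    using assms by (auto simp: linked_def)
  then have "matched (map h w1) (map h w2)"
    using assms matched_map_iff[OF assms(1), of w1 w2] by auto
  then show ?thesis
    unfolding linked_def w by auto
qed

lemma admissible_map:
  assumes "strict_mono_on T h" "admissible Bs" "set (concat Bs) \<subseteq> T"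
  shows "admissible (map (map h) Bs)"
  using assms(2,3)
proof (induction Bs)
  case (Cons B Bs)
  then have B: "brick B" "set B \<subseteq> T" and IH: "admissible (map (map h) Bs)"
    by (auto simp: admissible_Cons)
  have "brick (map h B)"
    using B incr_map_iff[OF assms(1)] by (simp add: brick_def)
  moreover have "linked (map h B) (hd (map (map h) Bs))" if "Bs \<noteq> []"
  proof -
    have "linked B (hd Bs)" "hd Bs \<noteq> []" "B \<noteq> []" "set (hd Bs) \<subseteq> T"
      using Cons.prems that by (auto simp: admissible_def brick_def neq_Nil_conv)
    then show ?thesis
      using that B linked_map[OF assms(1)] by (simp add: hd_map)
  qed
  ultimately show ?case
    using IH by (simp add: admissible_Cons)
qed simp

lemma tilings_map:
  assumes "strict_mono_on S h" "Bs \<in> tilings S"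
  shows "map (map h) Bs \<in> tilings (h ` S)"
proof -
  have "distinct (map h (concat Bs))"
    using assms strict_mono_on_imp_inj_on[OF assms(1)] by (simp add: tilings_def distinct_map)
  then show ?thesis
    using assms admissible_map[OF assms(1)] by (auto simp: tilings_def map_concat)
qed

lemma avoiders_map:
  assumes "strict_mono_on S h" "\<sigma> \<in> avoiders S"
  shows "map h \<sigma> \<in> avoiders (h ` S)"
  using assms avoids_map[OF assms(1)] strict_mono_on_imp_inj_on[OF assms(1)]
  by (auto simp: avoiders_def permutations_of_set_def distinct_map)

text \<open>Relabelling preserves brick lengths. Taking \<open>F\<close> on the list of lengths
  covers both the weight of a tiling and a restriction on its first brick.\<close>

lemma sum_tilings_cong_card:
  fixes F :: "nat list \<Rightarrow> 'a :: comm_monoid_add"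
  assumes "finite S" "finite T" "card S = card T"
  shows "(\<Sum>Bs\<in>tilings S. F (map length Bs)) = (\<Sum>Bs\<in>tilings T. F (map length Bs))"
proof -
  obtain h g where hg: "strict_mono_on S h" "h ` S = T" "strict_mono_on T g" "g ` T = S"
    "\<And>x. x \<in> S \<Longrightarrow> g (h x) = x" "\<And>y. y \<in> T \<Longrightarrow> h (g y) = y"
    using exists_order_iso[OF assms] by metis
  show ?thesis
  proof (rule sum.reindex_bij_witness[where i = "map (map g)" and j = "map (map h)"])
    fix Bs assume Bs: "Bs \<in> tilings S"
    show "map (map g) (map (map h) Bs) = Bs"
      using Bs hg(5) by (fastforce simp: tilings_def intro!: map_idI)
    show "map (map h) Bs \<in> tilings T"
      using tilings_map[OF hg(1) Bs] hg(2) by simp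
    show "F (map length (map (map h) Bs)) = F (map length Bs)"
      by (simp add: comp_def)
  next
    fix Bs assume Bs: "Bs \<in> tilings T"
    show "map (map h) (map (map g) Bs) = Bs"
      using Bs hg(6) by (fastforce simp: tilings_def intro!: map_idI)
    show "map (map g) Bs \<in> tilings S"
      using tilings_map[OF hg(3) Bs] hg(4) by simp
  qed
qed

lemma sum_avoiders_cong_card:
  fixes F :: "nat \<Rightarrow> 'a :: comm_monoid_add"
  assumes "finite S" "finite T" "card S = card T"
  shows "(\<Sum>\<sigma>\<in>avoiders S. F (des \<sigma>)) = (\<Sum>\<sigma>\<in>avoiders T. F (des \<sigma>))"
proof -
  obtain h g where hg: "strict_mono_on S h" "h ` S = T" "strict_mono_on T g" "g ` T = S"
    "\<And>x. x \<in> S \<Longrightarrow> g (h x) = x" "\<And>y. y \<in> T \<Longrightarrow> h (g y) = y"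
    using exists_order_iso[OF assms] by metis
  have set_av: "set \<sigma> = S'" if "\<sigma> \<in> avoiders S'" for \<sigma> S'
    using that by (simp add: avoiders_def permutations_of_set_def)
  show ?thesis
  proof (rule sum.reindex_bij_witness[where i = "map g" and j = "map h"])
    fix \<sigma> assume \<sigma>: "\<sigma> \<in> avoiders S"
    show "map g (map h \<sigma>) = \<sigma>"
      using set_av[OF \<sigma>] hg(5) by (auto intro!: map_idI)
    show "map h \<sigma> \<in> avoiders T"
      using avoiders_map[OF hg(1) \<sigma>] hg(2) by simp
    show "F (des (map h \<sigma>)) = F (des \<sigma>)"
      using des_map[OF hg(1)] set_av[OF \<sigma>] by simp
  next
    fix \<sigma> assume \<sigma>: "\<sigma> \<in> avoiders T"
    show "map h (map g \<sigma>) = \<sigma>"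
      using set_av[OF \<sigma>] hg(6) by (auto intro!: map_idI)
    show "map g \<sigma> \<in> avoiders S"
      using avoiders_map[OF hg(3) \<sigma>] hg(4) by simp
  qed
qed

lemma finite_avoiders [simp]: "finite S \<Longrightarrow> finite (avoiders S)"
  by (simp add: avoiders_def)

lemma finite_tilings [simp]:
  assumes "finite S"
  shows "finite (tilings S)"
proof (rule finite_subset)
  let ?L = "{B. set B \<subseteq> S \<and> length B \<le> s}"
  show "tilings S \<subseteq> {Bs. set Bs \<subseteq> ?L \<and> length Bs \<le> card S}"
  proof
    fix Bs assume Bs: "Bs \<in> tilings S"
    have "length Bs \<le> length (concat Bs)" if "\<forall>B\<in>set Bs. B \<noteq> []" for Bs :: "nat list list"
      using that
    proof (induction Bs)
      case (Cons B Bs)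
      then show ?case by (cases B) auto
    qed simp
    then have "length Bs \<le> length (concat Bs)"
      using Bs by (auto simp: tilings_def admissible_def brick_def)
    also have "\<dots> = card S"
      using Bs distinct_card[of "concat Bs"] by (simp add: tilings_def)
    finally show "Bs \<in> {Bs. set Bs \<subseteq> ?L \<and> length Bs \<le> card S}"
      using Bs by (auto simp: tilings_def admissible_def brick_def)
  qed
  show "finite {Bs. set Bs \<subseteq> ?L \<and> length Bs \<le> card S}"
    using assms by (intro finite_lists_length_le) 
qed

text \<open>
  The only descent of a pattern in \<open>\<Gamma>\<^bsub>k,k\<^esub>\<close> is in its middle, so a match created by
  appending \<open>C\<close> consists of the last \<open>k\<close> entries of the final run and the first \<open>k\<close> of \<open>C\<close>.
\<close>

lemma match_across_descent:
  assumes \<alpha>: "avoids (as @ R)" and R: "R \<noteq> []" "as = [] \<or> last as > hd R"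
    and C: "avoids C" and desc: "last R > hd C" and "\<not> avoids (as @ R @ C)"
  shows "\<exists>z w1 w2 v. R = z @ w1 \<and> C = w2 @ v \<and> matched w1 w2"
proof -
  obtain u w v where uwv: "(as @ R) @ C = u @ w @ v" and w: "pat w"
    using assms(6) by (auto simp: avoids_def)
  have no_w: "as @ R \<noteq> u' @ w @ v'" "C \<noteq> u' @ w @ v'" for u' v'
    using \<alpha> C w unfolding avoids_def by blast+
  \<comment> \<open>The pattern fits into neither \<open>as @ R\<close> nor \<open>C\<close>, so it
    straddles their boundary, with \<open>t\<close> before and \<open>x\<close> after it.\<close>
  obtain t x where tx: "as @ R = u @ t" "w = t @ x" "C = x @ v"
  proof -
    from uwv obtain x where "as @ R = u @ x \<and> x @ C = w @ v \<or> (as @ R) @ x = u \<and> C = x @ w @ v"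
      unfolding append_eq_append_conv2[of "as @ R"] by blast
    then have x: "as @ R = u @ x" "x @ C = w @ v"
      using no_w by auto
    then obtain x' where "x = w @ x' \<and> x' @ C = v \<or> x @ x' = w \<and> C = x' @ v"
      unfolding append_eq_append_conv2[of x] by blast
    then show thesis
      using x no_w that[of x x'] by auto
  qed
  have "t \<noteq> []" "x \<noteq> []"
    using no_w(1)[of u "[]"] no_w(2)[of "[]" v] tx by auto
  have "last t = last R" "hd C = hd x"
    using tx \<open>t \<noteq> []\<close> \<open>x \<noteq> []\<close> R(1) by (metis last_appendR, simp)
  then have desc': "last t > hd x"
    using desc by simp
  then have "\<not> incr w"
    using tx incr_append_last_less_hd \<open>t \<noteq> []\<close> \<open>x \<noteq> []\<close> by fastforce
  then obtain w1 w2 where w12: "w = w1 @ w2" "matched w1 w2"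
    using w by (auto simp: pat_def)
  then have inc: "incr w1" "incr w2" and ne: "w1 \<noteq> []" "w2 \<noteq> []"
    using k_ge_2 by (auto simp: matched_def)
  \<comment> \<open>The only place for the descent from \<open>t\<close> to \<open>x\<close> is the
    cut between the increasing halves \<open>w1\<close> and \<open>w2\<close>.\<close>
  have "t = w1 \<and> x = w2"
  proof -
    from w12 tx obtain q where "t = w1 @ q \<and> q @ x = w2 \<or> t @ q = w1 \<and> x = q @ w2"
      by (auto simp: append_eq_append_conv2)
    then show ?thesis
    proof
      assume q: "t = w1 @ q \<and> q @ x = w2"
      have "q = []"
      proof (rule ccontr)
        assume "q \<noteq> []"
        then have "last q < hd x" "last q = last t"
          using q inc \<open>x \<noteq> []\<close> incr_append_last_less_hd[of q x] by auto
        then show False using desc' by simp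
      qed
      then show ?thesis using q by simp
    next
      assume q: "t @ q = w1 \<and> x = q @ w2"
      have "q = []"
      proof (rule ccontr)
        assume "q \<noteq> []"
        then have "last t < hd q" "hd q = hd x"
          using q inc \<open>t \<noteq> []\<close> incr_append_last_less_hd[of t q] by auto
        then show False using desc' by simp
      qed
      then show ?thesis using q by simp
    qed
  qed
  \<comment> \<open>\<open>w1\<close> increases, so it cannot reach back across the descent before
    \<open>R\<close>.\<close>
  moreover obtain z where "R = z @ w1"
  proof -
    have "as @ R = u @ w1"
      using tx \<open>t = w1 \<and> x = w2\<close> by simp
    then obtain p where "as = u @ p \<and> p @ R = w1 \<or> as @ p = u \<and> R = p @ w1"
      by (auto simp: append_eq_append_conv2)
    then show thesis
    proof
      assume p: "as = u @ p \<and> p @ R = w1"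
      have "p = []"
      proof (rule ccontr)
        assume "p \<noteq> []"
        then have "last p < hd R" "last p = last as" "as \<noteq> []"
          using p inc R incr_append_last_less_hd[of p R] by auto
        then show False using R by simp
      qed
      then show thesis using p that[of "[]"] by simp
    qed (use that in blast)
  qed
  ultimately show ?thesis
    using w12 tx by blast
qed

subsection \<open>The sign-reversing involution\<close>

definition configs :: "nat set \<Rightarrow> (nat list \<times> nat list list) set" where
  "configs S = {(\<alpha>, Bs). avoids \<alpha> \<and> admissible Bs \<and> distinct (\<alpha> @ concat Bs) \<and>
     set \<alpha> \<union> set (concat Bs) = S}"

text \<open>Sorting by the label set \<open>T\<close> of the word yields a union of products, the
  source of the convolution.\<close>

lemma configs_eq_UN:
  "configs S = (\<Union>T\<in>Pow S. avoiders T \<times> tilings (S - T))"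
  by (auto simp: configs_def avoiders_def tilings_def permutations_of_set_def)

text \<open>The exponent of \<open>yvar\<close> is the number of increasing runs, hence 0 for the
  empty word; this matches the constant term 1 of \<open>NM_egf\<close>.\<close>

definition avoider_weight :: "nat list \<Rightarrow> rat poly" where
  "avoider_weight \<alpha> = (if \<alpha> = [] then 1 else yvar ^ (1 + des \<alpha>))"

definition config_weight :: "nat list \<times> nat list list \<Rightarrow> rat poly" where
  "config_weight = (\<lambda>(\<alpha>, Bs). avoider_weight \<alpha> * (- yvar) ^ length Bs)"

text \<open>
  The sign-reversing pairing: \<open>move\<close> appends the first brick to \<open>\<alpha>\<close>, creating a descent there
  (one factor \<open>y\<close>) while removing one factor \<open>- y\<close>. Its inverse cuts off the last increasing
  run of \<open>\<alpha>\<close>, so exactly one of the two moves is possible.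
\<close>

definition movable :: "nat list \<times> nat list list \<Rightarrow> bool" where
  "movable = (\<lambda>(\<alpha>, Bs). Bs \<noteq> [] \<and> (\<alpha> = [] \<or> last \<alpha> > hd (hd Bs)) \<and> avoids (\<alpha> @ hd Bs))"

definition move :: "nat list \<times> nat list list \<Rightarrow> nat list \<times> nat list list" where
  "move = (\<lambda>(\<alpha>, Bs). (\<alpha> @ hd Bs, tl Bs))"

text \<open>The moved brick is the last run of the new word, so \<open>last_run_unique\<close> gives
  injectivity. On \<open>S = {}\<close> the empty configuration would be neither movable nor an
  image.\<close>

lemma bij_betw_move:
  assumes "S \<noteq> {}"
  shows "bij_betw move {c \<in> configs S. movable c} {c \<in> configs S. \<not> movable c}"
  unfolding bij_betw_def
proof (intro conjI equalityI subsetI)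
  show "inj_on move {c \<in> configs S. movable c}"
  proof (rule inj_onI, clarify)
    fix \<alpha> Bs \<beta> Cs
    assume *: "(\<alpha>, Bs) \<in> configs S" "movable (\<alpha>, Bs)" "(\<beta>, Cs) \<in> configs S" "movable (\<beta>, Cs)"
      "move (\<alpha>, Bs) = move (\<beta>, Cs)"
    then obtain B Bs' C Cs' where BC: "Bs = B # Bs'" "Cs = C # Cs'"
      by (auto simp: movable_def neq_Nil_conv)
    then show "\<alpha> = \<beta> \<and> Bs = Cs"
      using * last_run_unique[of \<alpha> B \<beta> C]
      by (auto simp: move_def movable_def configs_def admissible_Cons brick_def)
  qed
next
  fix c assume "c \<in> move ` {c \<in> configs S. movable c}"
  then obtain \<alpha> Bs' where "c = move (\<alpha>, Bs')" "(\<alpha>, Bs') \<in> configs S" "movable (\<alpha>, Bs')"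
    by auto
  moreover then obtain B Bs where "Bs' = B # Bs"
    by (auto simp: movable_def neq_Nil_conv)
  ultimately have c: "c = (\<alpha> @ B, Bs)" and conf: "(\<alpha>, B # Bs) \<in> configs S"
    and mov: "movable (\<alpha>, B # Bs)"
    by (auto simp: move_def)
  have "c \<in> configs S"
    using conf mov by (auto simp: c configs_def movable_def admissible_Cons)
  \<comment> \<open>A second move would need a descent after \<open>B\<close>. The next brick is
    then linked to \<open>B\<close> by a match, and appending that brick would bring the match into
    the word.\<close>
  moreover have "\<not> movable c"
  proof
    assume "movable c"
    then have *: "Bs \<noteq> []" "last B > hd (hd Bs)" "avoids ((\<alpha> @ B) @ hd Bs)"
      using conf by (auto simp: c movable_def configs_def admissible_Cons brick_def)
    then obtain z w1 w2 v where "B = z @ w1" "hd Bs = w2 @ v" "matched w1 w2"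
      using conf by (auto simp: configs_def admissible_Cons linked_def)
    then have "(\<alpha> @ B) @ hd Bs = (\<alpha> @ z) @ (w1 @ w2) @ v" "pat (w1 @ w2)"
      by (auto simp: pat_def)
    then show False
      using *(3) unfolding avoids_def by metis
  qed
  ultimately show "c \<in> {c \<in> configs S. \<not> movable c}"
    by simp
next
  fix c assume "c \<in> {c \<in> configs S. \<not> movable c}"
  then obtain \<beta> Cs where c: "c = (\<beta>, Cs)" and conf: "(\<beta>, Cs) \<in> configs S"
    and nmov: "\<not> movable (\<beta>, Cs)"
    by (cases c) auto
  \<comment> \<open>Next to an empty word the first brick is always movable, and
    \<open>S \<noteq> {}\<close> supplies a first brick.\<close>
  have \<beta>: "\<beta> \<noteq> []"
  proof
    assume "\<beta> = []"
    moreover then obtain C Cs' where "Cs = C # Cs'"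
      using conf assms by (cases Cs) (auto simp: configs_def)
    ultimately show False
      using conf nmov avoids_incr_iff[of C]
      by (auto simp: configs_def movable_def admissible_Cons brick_def)
  qed
  then obtain as R where R: "\<beta> = as @ R" "R \<noteq> []" "incr R" "as = [] \<or> last as > hd R"
    using exists_last_run[of \<beta>] conf by (auto simp: configs_def)
  have av: "avoids (as @ R)"
    using conf R by (simp add: configs_def)
  have "brick R"
    using R av avoids_incr_iff avoids_appendD2 by (auto simp: brick_def)
  \<comment> \<open>After a descent the next brick fails to be movable only because appending it
    creates a match; \<open>match_across_descent\<close> locates this match at the boundary.\<close>
  moreover have "linked R (hd Cs)" if "Cs \<noteq> []"
  proof (cases "last R < hd (hd Cs)")
    case False
    have brick: "brick (hd Cs)"
      using conf that by (auto simp: configs_def admissible_def)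
    then have "hd (hd Cs) \<in> set (concat Cs)" "last R \<in> set \<beta>"
      using that R by (auto simp: brick_def neq_Nil_conv)
    then have "last R \<noteq> hd (hd Cs)"
      using conf by (auto simp: configs_def)
    then have desc: "last R > hd (hd Cs)"
      using False by simp
    then have "\<not> avoids (as @ R @ hd Cs)"
      using nmov that R by (auto simp: movable_def)
    then have "\<exists>z w1 w2 v. R = z @ w1 \<and> hd Cs = w2 @ v \<and> matched w1 w2"
      using av R desc brick avoids_incr_iff[of "hd Cs"]
      by (intro match_across_descent) (auto simp: brick_def)
    then show ?thesis
      by (simp add: linked_def)
  qed (simp add: linked_def)
  ultimately have "(as, R # Cs) \<in> configs S"
    using conf R avoids_appendD1[OF av] by (auto simp: configs_def admissible_Cons)
  moreover have "movable (as, R # Cs)"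
    using R av by (auto simp: movable_def)
  moreover have "move (as, R # Cs) = c"
    by (simp add: move_def c R)
  ultimately show "c \<in> move ` {c \<in> configs S. movable c}"
    by force
qed

lemma config_weight_move:
  assumes "c \<in> configs S" "movable c"
  shows "config_weight (move c) = - config_weight c"
proof -
  obtain \<alpha> B Bs where c: "c = (\<alpha>, B # Bs)"
    using assms by (cases c) (auto simp: movable_def neq_Nil_conv)
  have B: "B \<noteq> []" "incr B" and desc: "\<alpha> = [] \<or> last \<alpha> > hd B"
    using assms by (auto simp: c configs_def admissible_Cons brick_def movable_def)
  have "avoider_weight (\<alpha> @ B) = avoider_weight \<alpha> * yvar"
    using B desc by (auto simp: avoider_weight_def des_append des_incr)
  then show ?thesis
    by (simp add: c move_def config_weight_def)
qed

lemma finite_configs [simp]: "finite S \<Longrightarrow> finite (configs S)"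
  unfolding configs_eq_UN by (auto dest: finite_subset)

lemma sum_config_weight_eq_0:
  assumes "finite S" "S \<noteq> {}"
  shows "(\<Sum>c\<in>configs S. config_weight c) = 0"
proof -
  let ?M = "{c \<in> configs S. movable c}" and ?N = "{c \<in> configs S. \<not> movable c}"
  have "(\<Sum>c\<in>?N. config_weight c) = (\<Sum>c\<in>?M. config_weight (move c))"
    using sum.reindex_bij_betw[OF bij_betw_move[OF assms(2)], of config_weight] by simp
  also have "\<dots> = - (\<Sum>c\<in>?M. config_weight c)"
    using config_weight_move[of _ S] by (simp add: sum_negf[symmetric])
  finally have "(\<Sum>c\<in>?M. config_weight c) + (\<Sum>c\<in>?N. config_weight c) = 0"
    by simp
  moreover have "configs S = ?M \<union> ?N" "?M \<inter> ?N = {}"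
    by auto
  ultimately show ?thesis
    using assms(1) by (metis (lifting) sum.union_disjoint finite_Un finite_configs)
qed

section \<open>Inverse exponential generating functions\<close>

definition tiling_weight :: "nat list list \<Rightarrow> rat poly" where
  "tiling_weight Bs = (- yvar) ^ length Bs"

definition tiling_sum :: "nat \<Rightarrow> rat poly" where
  "tiling_sum n = (\<Sum>Bs\<in>tilings {1..n}. tiling_weight Bs)"

definition avoider_sum :: "nat \<Rightarrow> rat poly" where
  "avoider_sum n = (\<Sum>\<sigma>\<in>avoiders {1..n}. avoider_weight \<sigma>)"

lemma sum_tiling_weight:
  assumes "finite S"
  shows "(\<Sum>Bs\<in>tilings S. tiling_weight Bs) = tiling_sum (card S)"
  unfolding tiling_sum_def tiling_weight_def
  using sum_tilings_cong_card[of S "{1..card S}" "\<lambda>l. (- yvar) ^ length l"] assms by simp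

lemma sum_avoider_weight:
  assumes "finite S"
  shows "(\<Sum>\<sigma>\<in>avoiders S. avoider_weight \<sigma>) = avoider_sum (card S)"
proof -
  \<comment> \<open>The word is empty exactly if its label set is, so on a fixed set the weight
    depends on \<open>des\<close> alone.\<close>
  have eq: "(\<Sum>\<sigma>\<in>avoiders T. avoider_weight \<sigma>) =
      (\<Sum>\<sigma>\<in>avoiders T. if card T = 0 then 1 else yvar ^ (1 + des \<sigma>))" if "finite T" for T
    using that by (intro sum.cong) (auto simp: avoider_weight_def avoiders_def permutations_of_set_def)
  show ?thesis
    unfolding avoider_sum_def
    using assms sum_avoiders_cong_card[of S "{1..card S}"
        "\<lambda>d. if card S = 0 then 1 else yvar ^ (1 + d)"]
    by (simp add: eq)
qed

text \<open>The cancelling sum over \<open>configs {1..n}\<close>, grouped by the size of the label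
  set of the word.\<close>

lemma convolution_eq_0:
  assumes "n \<ge> 1"
  shows "(\<Sum>i\<le>n. of_nat (n choose i) * (avoider_sum i * tiling_sum (n - i))) = 0"
proof -
  let ?S = "{1..n}"
  have "0 = (\<Sum>c\<in>configs ?S. config_weight c)"
    using assms by (intro sum_config_weight_eq_0[symmetric]) auto
  also have "\<dots> = (\<Sum>T\<in>Pow ?S. \<Sum>c\<in>avoiders T \<times> tilings (?S - T). config_weight c)"
    unfolding configs_eq_UN
  proof (rule sum.UNION_disjoint)
    show "\<forall>T\<in>Pow ?S. finite (avoiders T \<times> tilings (?S - T))"
      by (auto intro!: finite_cartesian_product dest: finite_subset)
    show "\<forall>T\<in>Pow ?S. \<forall>T'\<in>Pow ?S. T \<noteq> T' \<longrightarrow>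
        (avoiders T \<times> tilings (?S - T)) \<inter> (avoiders T' \<times> tilings (?S - T')) = {}"
      by (auto simp: avoiders_def permutations_of_set_def)
  qed simp
  also have "\<dots> = (\<Sum>T\<in>Pow ?S. avoider_sum (card T) * tiling_sum (n - card T))"
  proof (rule sum.cong)
    fix T assume "T \<in> Pow ?S"
    then have T: "T \<subseteq> ?S" "finite T"
      by (auto dest: finite_subset)
    have "(\<Sum>c\<in>avoiders T \<times> tilings (?S - T). config_weight c) =
        (\<Sum>\<sigma>\<in>avoiders T. avoider_weight \<sigma>) * (\<Sum>Bs\<in>tilings (?S - T). tiling_weight Bs)"
      by (simp add: sum_product sum.cartesian_product config_weight_def tiling_weight_def)
    then show "(\<Sum>c\<in>avoiders T \<times> tilings (?S - T). config_weight c) =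
        avoider_sum (card T) * tiling_sum (n - card T)"
      using T by (simp add: sum_avoider_weight sum_tiling_weight card_Diff_subset)
  qed simp
  also have "\<dots> = (\<Sum>i\<le>n. of_nat (n choose i) * (avoider_sum i * tiling_sum (n - i)))"
    using sum_Pow_card[of ?S "\<lambda>i. avoider_sum i * tiling_sum (n - i)"] by simp
  finally show ?thesis ..
qed

lemma tilings_empty [simp]: "tilings {} = {[]}"
proof -
  have "Bs = []" if "Bs \<in> tilings {}" for Bs
    using that by (cases Bs) (auto simp: tilings_def admissible_Cons brick_def)
  then show ?thesis
    by (auto simp: tilings_def)
qed

lemma tiling_sum_0 [simp]: "tiling_sum 0 = 1"
  by (simp add: tiling_sum_def tiling_weight_def)

lemma avoider_sum_0 [simp]: "avoider_sum 0 = 1"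
proof -
  have "avoiders {} = {[]}"
    by (auto simp: avoiders_def)
  then show ?thesis
    by (simp add: avoider_sum_def avoider_weight_def)
qed

lemma NM_egf_nth: "fps_nth (NM_egf (Gamma3 k k s)) n = smult (1 / fact n) (avoider_sum n)"
proof (cases "n = 0")
  case False
  have "avoider_sum n = (\<Sum>\<sigma>\<in>NM (Gamma3 k k s) n. yvar ^ (1 + des \<sigma>))"
    unfolding avoider_sum_def avoiders_def NM_Gamma3_eq avoider_weight_def using False
    by (intro sum.cong) (auto simp: permutations_of_set_def)
  then show ?thesis
    using False by (simp add: NM_egf_def)
qed (simp add: NM_egf_def)

lemma U_Gamma3_eq: "U (Gamma3 k k s) j = (if j < 0 then 0 else tiling_sum (nat j))"
proof -
  let ?A = "NM_egf (Gamma3 k k s)" and ?V = "Abs_fps (\<lambda>n. smult (1 / fact n) (tiling_sum n))"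
    and ?U = "Abs_fps (\<lambda>n. smult (1 / fact n) (U (Gamma3 k k s) (int n)))"
  have AV: "?A * ?V = 1"
  proof (rule fps_ext)
    fix n
    have "fps_nth (?A * ?V) n =
        (\<Sum>i\<le>n. smult (1 / (fact i * fact (n - i))) (avoider_sum i * tiling_sum (n - i)))"
      by (simp add: fps_mult_nth NM_egf_nth atLeast0AtMost mult.commute)
    also have "\<dots> = (\<Sum>i\<le>n. smult (1 / fact n)
        (of_nat (n choose i) * (avoider_sum i * tiling_sum (n - i))))"
      by (intro sum.cong) (simp_all add: binomial_fact of_nat_poly)
    also have "\<dots> = smult (1 / fact n)
        (\<Sum>i\<le>n. of_nat (n choose i) * (avoider_sum i * tiling_sum (n - i)))"
      by (rule smult_sum_distrib[symmetric])
    also have "\<dots> = fps_nth 1 n"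
      by (cases "n = 0") (simp_all add: convolution_eq_0)
    finally show "fps_nth (?A * ?V) n = fps_nth 1 n" .
  qed
  \<comment> \<open>Uniqueness of the inverse in a commutative ring.\<close>
  have "?U = ?U * (?A * ?V)"
    by (simp only: AV mult_1_right)
  also have "\<dots> = (?A * ?U) * ?V"
    by (simp only: mult_ac)
  also have "\<dots> = ?V"
    by (simp only: NM_egf_times_U_egf mult_1_left)
  finally have "?U = ?V" .
  then have "fps_nth ?U n = fps_nth ?V n" for n
    by simp
  then have "U (Gamma3 k k s) (int n) = tiling_sum n" for n
    by (simp add: smult_eq_iff)
  from this[of "nat j"] show ?thesis
    by (auto simp: U_def)
qed

subsection \<open>Removing the first brick\<close>

text \<open>Under a match, \<open>hd B\<close> is at most \<open>w1 ! 0\<close>, which is less than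
  \<open>w2 ! 0\<close>, the head of \<open>C\<close>.\<close>

lemma hd_le_hd_of_linked:
  assumes "brick B" "brick C" "linked B C"
  shows "hd B \<le> hd C"
proof (cases "last B < hd C")
  case True
  then show ?thesis
    using assms incr_hd_le[of B "last B"] by (simp add: brick_def)
next
  case False
  then obtain z w1 w2 v where w: "B = z @ w1" "C = w2 @ v" "matched w1 w2"
    using assms by (auto simp: linked_def)
  then have "w1 \<noteq> []" "w2 \<noteq> []"
    using k_ge_2 by (auto simp: matched_def)
  then have "hd B \<le> hd w1" "hd w1 < hd w2"
    using assms w incr_hd_le[of B "hd w1"] by (auto simp: brick_def matched_def hd_conv_nth)
  then show ?thesis
    using w \<open>w2 \<noteq> []\<close> by simp
qed

lemma admissible_hd_le:
  "admissible Bs \<Longrightarrow> x \<in> set (concat Bs) \<Longrightarrow> hd (hd Bs) \<le> x"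
proof (induction Bs)
  case (Cons B Bs)
  then have B: "brick B" "admissible Bs"
    by (auto simp: admissible_Cons)
  show ?case
  proof (cases "x \<in> set B")
    case True
    then show ?thesis
      using B incr_hd_le by (simp add: brick_def)
  next
    case False
    then have x: "x \<in> set (concat Bs)" "Bs \<noteq> []"
      using Cons.prems by auto
    then have "brick (hd Bs)" "linked B (hd Bs)"
      using Cons.prems by (auto simp: admissible_def neq_Nil_conv)
    then show ?thesis
      using Cons.IH[OF B(2) x(1)] hd_le_hd_of_linked[OF B(1)] by fastforce
  qed
qed simp

lemma hd_hd_mem: "admissible Bs \<Longrightarrow> Bs \<noteq> [] \<Longrightarrow> hd (hd Bs) \<in> set (concat Bs)"
  by (cases Bs) (auto simp: admissible_def brick_def)

text \<open>A single brick counts as rising, so a tiling that is not rising has a second brick,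
  preceded by a descent.\<close>

definition rising :: "nat list list \<Rightarrow> bool" where
  "rising Bs \<longleftrightarrow> tl Bs = [] \<or> last (hd Bs) < hd (hd (tl Bs))"

text \<open>All later entries are at least the head of the second brick, hence exceed the first
  brick. The first brick thus takes the \<open>r\<close> smallest labels, and any tiling of the rest
  may follow.\<close>

lemma rising_tilings_eq:
  assumes r: "1 \<le> r" "r \<le> s" "r \<le> n"
  shows "{Bs \<in> tilings {1..n}. Bs \<noteq> [] \<and> rising Bs \<and> length (hd Bs) = r} =
    Cons [1..<r + 1] ` tilings {r + 1..n}"
proof (intro equalityI subsetI)
  fix Bs assume *: "Bs \<in> {Bs \<in> tilings {1..n}. Bs \<noteq> [] \<and> rising Bs \<and> length (hd Bs) = r}"
  then obtain B Cs where Bs: "Bs = B # Cs"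
    by (auto simp: neq_Nil_conv)
  have B: "B \<noteq> []" "incr B" "length B = r" and Cs: "admissible Cs" and
    disj: "set B \<inter> set (concat Cs) = {}" "distinct (concat Cs)" and
    un: "set B \<union> set (concat Cs) = {1..n}" and
    rise: "Cs = [] \<or> last B < hd (hd Cs)"
    using * by (auto simp: Bs tilings_def admissible_Cons brick_def rising_def)
  have Cs_gt: "last B < x" if "x \<in> set (concat Cs)" for x
    using rise admissible_hd_le[OF Cs that] that by auto
  have "last B \<in> {1..n}"
    using un B by auto
  have mem: "x \<in> set B \<or> x \<in> set (concat Cs) \<longleftrightarrow> 1 \<le> x \<and> x \<le> n" for x
    using un by (metis Un_iff atLeastAtMost_iff)
  have set_B: "set B = {1..last B}"
  proof (intro set_eqI)
    fix x
    show "x \<in> set B \<longleftrightarrow> x \<in> {1..last B}"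
      using incr_le_last[OF B(2), of x] Cs_gt[of x] mem[of x] \<open>last B \<in> {1..n}\<close>
      unfolding atLeastAtMost_iff by linarith
  qed
  then have "last B = r"
    using B distinct_card[OF incr_distinct[OF B(2)]] by simp
  have "set B = set [1..<r + 1]"
    using set_B unfolding \<open>last B = r\<close>
    by (simp del: upt_Suc add: atLeastLessThanSuc_atLeastAtMost)
  then have "B = [1..<r + 1]"
    by (rule incr_eq_of_set_eq[OF B(2) sorted_wrt_upt])
  moreover have "set (concat Cs) = {r + 1..n}"
  proof (intro set_eqI)
    fix x
    have "x \<in> set B \<longleftrightarrow> 1 \<le> x \<and> x \<le> r"
      using set_B \<open>last B = r\<close> by simp
    then show "x \<in> set (concat Cs) \<longleftrightarrow> x \<in> {r + 1..n}"
      using mem[of x] Cs_gt[of x] \<open>last B = r\<close> unfolding atLeastAtMost_iff by linarith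
  qed
  ultimately show "Bs \<in> Cons [1..<r + 1] ` tilings {r + 1..n}"
    using Cs disj by (auto simp: Bs tilings_def simp del: upt_Suc)
next
  fix Bs assume "Bs \<in> Cons [1..<r + 1] ` tilings {r + 1..n}"
  then obtain Cs where Bs: "Bs = [1..<r + 1] # Cs" and Cs: "Cs \<in> tilings {r + 1..n}"
    by blast
  have last: "last [1..<r + 1] < hd (hd Cs)" if "Cs \<noteq> []"
  proof -
    have "hd (hd Cs) \<in> {r + 1..n}"
      using hd_hd_mem[OF _ that] Cs unfolding tilings_def by blast
    then show ?thesis
      using r by simp
  qed
  then have adm: "admissible Bs"
    using Cs r by (auto simp: Bs tilings_def admissible_Cons brick_def linked_def simp del: upt_Suc)
  have set_Cs: "set (concat Cs) = {r + 1..n}" "distinct (concat Cs)"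
    using Cs by (simp_all only: tilings_def mem_Collect_eq)
  have "distinct (concat Bs)"
    using set_Cs unfolding Bs concat.simps distinct_append by (simp del: upt_Suc set_concat) auto
  moreover have "set (concat Bs) = {1..n}"
    using set_Cs(1) r unfolding Bs concat.simps set_append by (auto simp del: upt_Suc set_concat)
  ultimately show "Bs \<in> {Bs \<in> tilings {1..n}. Bs \<noteq> [] \<and> rising Bs \<and> length (hd Bs) = r}"
    using last adm by (auto simp: tilings_def rising_def Bs simp del: upt_Suc)
qed

abbreviation u :: "int \<Rightarrow> rat poly" where
  "u \<equiv> U (Gamma3 k k s)"

lemma sum_rising_tilings:
  assumes "1 \<le> r" "r \<le> s"
  shows "(\<Sum>Bs | Bs \<in> tilings {1..n} \<and> Bs \<noteq> [] \<and> rising Bs \<and> length (hd Bs) = r.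
    tiling_weight Bs) = - yvar * u (int n - int r)" (is "?L = _")
proof (cases "r \<le> n")
  case True
  have "?L = (\<Sum>Bs\<in>Cons [1..<r + 1] ` tilings {r + 1..n}. tiling_weight Bs)"
    using rising_tilings_eq[OF assms True] by simp
  also have "\<dots> = - yvar * (\<Sum>Bs\<in>tilings {r + 1..n}. tiling_weight Bs)"
    by (simp add: sum.reindex sum_distrib_left tiling_weight_def del: upt_Suc)
  also have "(\<Sum>Bs\<in>tilings {r + 1..n}. tiling_weight Bs) = u (int n - int r)"
    using True by (simp add: sum_tiling_weight U_Gamma3_eq nat_diff_distrib)
  finally show ?thesis .
next
  \<comment> \<open>No brick can hold more than \<open>n\<close> labels, in accordance with
    \<open>u\<close> being 0 at negative arguments.\<close>
  case False
  have "length (hd Bs) \<le> n" if "Bs \<in> tilings {1..n}" "Bs \<noteq> []" for Bs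
  proof -
    have "set (hd Bs) \<subseteq> {1..n}" "distinct (hd Bs)"
      using that by (auto simp: tilings_def neq_Nil_conv)
    then show ?thesis
      using card_mono[of "{1..n}" "set (hd Bs)"] by (simp add: distinct_card)
  qed
  then have "{Bs. Bs \<in> tilings {1..n} \<and> Bs \<noteq> [] \<and> rising Bs \<and> length (hd Bs) = r} = {}"
    using False by auto
  then show ?thesis
    using False by (simp add: U_Gamma3_eq del: Collect_empty_eq)
qed

text \<open>The first brick has room for the half \<open>w2\<close> of a match.\<close>

definition starts_long :: "nat list list \<Rightarrow> bool" where
  "starts_long Bs \<longleftrightarrow> Bs \<noteq> [] \<and> k \<le> length (hd Bs)"

text \<open>The match takes the last \<open>k\<close> entries of the first brick; \<open>p\<close>
  counts those before it.\<close>

definition falling :: "nat \<Rightarrow> nat \<Rightarrow> nat list list set" where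
  "falling n p = {Bs \<in> tilings {1..n}. Bs \<noteq> [] \<and> \<not> rising Bs \<and> length (hd Bs) = p + k}"

text \<open>
  If the first brick is followed by a descent, the match forces its first \<open>p + 1\<close> entries to be
  \<open>1, \<dots>, p + 1\<close> and the second brick to start with \<open>p + 2\<close>; the other \<open>k - 1\<close> entries
  \<open>X\<close> of the first brick are arbitrary.
\<close>

lemma falling_decompose:
  assumes "Bs \<in> falling n p"
  obtains X Cs where "Bs = ([1..<p + 2] @ sorted_list_of_set X) # Cs"
    "X \<subseteq> {p + 3..n}" "card X = k - 1" "Cs \<in> tilings ({p + 2..n} - X)" "starts_long Cs"
proof -
  obtain B Cs where Bs: "Bs = B # Cs"
    using assms by (auto simp: falling_def neq_Nil_conv)
  have B: "incr B" "length B = p + k" and Cs: "admissible Cs" "Cs \<noteq> []" and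
    disj: "set B \<inter> set (concat Cs) = {}" and dist: "distinct (concat Cs)" and
    un: "set B \<union> set (concat Cs) = {1..n}" and
    fall: "\<not> last B < hd (hd Cs)" and "linked B (hd Cs)"
    using assms
    by (auto simp: Bs tilings_def admissible_Cons brick_def rising_def falling_def)
  then obtain z w1 w2 v where w: "B = z @ w1" "hd Cs = w2 @ v" "matched w1 w2"
    by (auto simp: linked_def)
  \<comment> \<open>The head \<open>c\<close> of the second brick lies between the first two entries
    \<open>a\<close> and \<open>b\<close> of \<open>w1\<close>.\<close>
  then obtain a b ws where w1: "w1 = a # b # ws"
    using k_ge_2 by (cases w1; cases "tl w1") (auto simp: matched_def)
  define c where "c = hd (hd Cs)"
  have "w2 \<noteq> []"
    using w k_ge_2 by (auto simp: matched_def)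
  then have c_eq: "c = w2 ! 0"
    using w hd_conv_nth[of w2] by (simp add: c_def)
  have abc: "a < c" "c < b"
    using w by (auto simp: c_eq w1 matched_def)
  have c_mem: "c \<in> set (concat Cs)"
    unfolding c_def by (rule hd_hd_mem[OF Cs])
  have c_le: "c \<le> x" if "x \<in> set (concat Cs)" for x
    unfolding c_def by (rule admissible_hd_le[OF Cs(1) that])
  let ?X = "set (b # ws)"
  have B_eq: "B = (z @ [a]) @ (b # ws)"
    by (simp add: w w1)
  have inc: "incr (z @ [a])" "incr (b # ws)"
    using B(1) unfolding B_eq sorted_wrt_append by blast+
  have small: "x < c" if "x \<in> set (z @ [a])" for x
    using incr_le_last[OF inc(1) that] abc by simp
  have large: "c < x" if "x \<in> ?X" for x
    using incr_hd_le[OF inc(2) that] abc by simp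
  have mem: "x \<in> set (z @ [a]) \<or> x \<in> ?X \<or> x \<in> set (concat Cs) \<longleftrightarrow> 1 \<le> x \<and> x \<le> n" for x
    using un unfolding B_eq set_append[of "z @ [a]"] by (metis Un_iff atLeastAtMost_iff)
  have len: "length z = p" "length ws = k - 2"
    using B w w1 by (auto simp: matched_def)
  \<comment> \<open>Labels below \<open>c\<close> occur neither in \<open>b # ws\<close> nor in
    \<open>Cs\<close>, so \<open>z @ [a]\<close> contains all of them; counting gives
    \<open>c = p + 2\<close>.\<close>
  have set_za: "set (z @ [a]) = {1..<c}"
  proof (intro set_eqI)
    fix x
    show "x \<in> set (z @ [a]) \<longleftrightarrow> x \<in> {1..<c}"
      using mem[of x] mem[of c] c_mem small[of x] large[of x] c_le[of x]
      unfolding atLeastLessThan_iff by linarith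
  qed
  then have "c = p + 2"
    using distinct_card[OF incr_distinct[OF inc(1)]] len mem[of c] c_mem by simp
  have "z @ [a] = [1..<p + 2]"
    using set_za \<open>c = p + 2\<close> by (intro incr_eq_of_set_eq[OF inc(1) sorted_wrt_upt]) (simp del: upt_Suc)
  moreover have "b # ws = sorted_list_of_set ?X"
    by (rule incr_eq_of_set_eq[OF inc(2) strict_sorted_list_of_set])
      (rule set_sorted_list_of_set[OF finite_set, symmetric])
  ultimately have "Bs = ([1..<p + 2] @ sorted_list_of_set ?X) # Cs"
    using Bs B_eq by metis
  moreover have "?X \<subseteq> {p + 3..n}"
  proof
    fix x assume "x \<in> ?X"
    then show "x \<in> {p + 3..n}"
      using large[of x] mem[of x] \<open>c = p + 2\<close> unfolding atLeastAtMost_iff by linarith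
  qed
  moreover have "card ?X = k - 1"
    using distinct_card[OF incr_distinct[OF inc(2)]] len k_ge_2 by simp
  moreover have "set (concat Cs) = {p + 2..n} - ?X"
  proof (intro set_eqI)
    fix x
    have "x \<in> ?X \<Longrightarrow> x \<notin> set (concat Cs)"
      using disj unfolding B_eq by auto
    then show "x \<in> set (concat Cs) \<longleftrightarrow> x \<in> {p + 2..n} - ?X"
      using mem[of x] small[of x] c_le[of x] \<open>c = p + 2\<close>
      unfolding atLeastAtMost_iff Diff_iff by linarith
  qed
  then have "Cs \<in> tilings ({p + 2..n} - ?X)"
    using Cs(1) dist unfolding tilings_def by blast
  moreover have "starts_long Cs"
    using Cs w by (simp add: starts_long_def matched_def)
  ultimately show thesis
    by (rule that)
qed

text \<open>\<open>X\<close> leaves \<open>p + 2\<close> to \<open>Cs\<close>, as its least label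
  and so its head. It lies between \<open>p + 1\<close> and all of \<open>X\<close>, which yields
  the match that links the bricks.\<close>

lemma falling_compose:
  assumes p: "p + k \<le> s" and X: "X \<subseteq> {p + 3..n}" "card X = k - 1"
    and Cs: "Cs \<in> tilings ({p + 2..n} - X)" "starts_long Cs"
  shows "([1..<p + 2] @ sorted_list_of_set X) # Cs \<in> falling n p"
proof -
  let ?l = "sorted_list_of_set X"
  let ?B = "[1..<p + 2] @ ?l"
  have fin: "finite X"
    using X(1) finite_subset by blast
  have l: "set ?l = X" "incr ?l" "length ?l = k - 1"
    using fin X(2) by simp_all
  have l_ne: "?l \<noteq> []"
  proof -
    have "length ?l \<noteq> 0"
      unfolding l(3) using k_ge_2 by simp
    then show ?thesis
      by (metis length_0_conv)
  qed
  have incB: "incr ?B"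
    using X(1) l unfolding sorted_wrt_append by (auto simp del: upt_Suc)
  have adm: "admissible Cs" and Cs_ne: "Cs \<noteq> []" and Cs_len: "k \<le> length (hd Cs)"
    and set_Cs: "set (concat Cs) = {p + 2..n} - X" and dist: "distinct (concat Cs)"
    using Cs unfolding tilings_def starts_long_def by blast+
  have "hd (hd Cs) \<in> {p + 2..n} - X"
    using hd_hd_mem[OF adm Cs_ne] unfolding set_Cs .
  then have ge: "p + 2 \<le> hd (hd Cs)" "p + 2 \<le> n"
    by auto
  then have "p + 2 \<in> set (concat Cs)"
    unfolding set_Cs using X(1) by auto
  then have hd_Cs: "hd (hd Cs) = p + 2"
    using admissible_hd_le[OF adm] ge by (simp add: le_antisym del: set_concat)
  have last_B: "last ?B > p + 2"
    using l_ne last_in_set[OF l_ne] X(1) unfolding l(1) by auto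
  have brick_hd: "brick (hd Cs)"
    using adm Cs_ne by (simp add: admissible_def)
  have "hd Cs \<noteq> []"
    using brick_hd by (simp add: brick_def)
  have "?l ! 0 \<in> X"
    using l_ne l(1) by (metis length_greater_0_conv nth_mem)
  then have "matched ((p + 1) # ?l) (take k (hd Cs))"
    using incB l Cs_len k_ge_2 X(1) brick_hd hd_Cs \<open>hd Cs \<noteq> []\<close>
    by (auto simp: matched_def brick_def sorted_wrt_take hd_conv_nth sorted_wrt_append)
  moreover have "?B = [1..<p + 1] @ ((p + 1) # ?l)" "hd Cs = take k (hd Cs) @ drop k (hd Cs)"
    by simp_all
  ultimately have "linked ?B (hd Cs)"
    unfolding linked_def by blast
  moreover have len_B: "length ?B = p + k"
    using l(3) k_ge_2 by simp
  ultimately have "admissible (?B # Cs)"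
    using adm incB p k_ge_2 by (simp add: admissible_Cons brick_def del: upt_Suc length_append)
  moreover have "set (concat (?B # Cs)) = {1..n}"
    unfolding concat.simps set_append set_Cs l(1) using X(1) ge(2) by (auto simp del: upt_Suc)
  moreover have "distinct (concat (?B # Cs))"
    unfolding concat.simps distinct_append[of ?B] set_append set_Cs l(1)
    using dist incr_distinct[OF incB] by (auto simp del: upt_Suc)
  ultimately have "?B # Cs \<in> tilings {1..n}"
    unfolding tilings_def by blast
  moreover have "\<not> rising (?B # Cs)"
    using last_B hd_Cs Cs_ne by (simp add: rising_def del: upt_Suc last_appendR)
  ultimately show ?thesis
    using len_B by (simp add: falling_def del: upt_Suc length_append)
qed

definition long_sum :: "nat \<Rightarrow> rat poly" where
  "long_sum n = (\<Sum>Bs | Bs \<in> tilings {1..n} \<and> starts_long Bs. tiling_weight Bs)"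

lemma sum_starts_long:
  assumes "finite S"
  shows "(\<Sum>Bs | Bs \<in> tilings S \<and> starts_long Bs. tiling_weight Bs) = long_sum (card S)"
proof -
  \<comment> \<open>The restriction \<open>starts_long\<close>, rewritten as a function of the brick
    lengths.\<close>
  define F :: "nat list \<Rightarrow> rat poly"
    where "F ls = (if ls \<noteq> [] \<and> k \<le> hd ls then (- yvar) ^ length ls else 0)" for ls
  have "(\<Sum>Bs | Bs \<in> tilings T \<and> starts_long Bs. tiling_weight Bs) =
      (\<Sum>Bs\<in>tilings T. F (map length Bs))" if "finite T" for T
  proof -
    have "(\<Sum>Bs | Bs \<in> tilings T \<and> starts_long Bs. tiling_weight Bs) =
        (\<Sum>Bs\<in>tilings T. if starts_long Bs then tiling_weight Bs else 0)"
      using that by (intro sum.inter_filter) simp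
    also have "\<dots> = (\<Sum>Bs\<in>tilings T. F (map length Bs))"
      by (intro sum.cong) (auto simp: F_def starts_long_def tiling_weight_def hd_map)
    finally show ?thesis .
  qed
  then show ?thesis
    using assms sum_tilings_cong_card[of S "{1..card S}" F] by (simp add: long_sum_def)
qed

text \<open>A falling tiling amounts to a subset \<open>X\<close> of \<open>{p + 3..n}\<close> of
  size \<open>k - 1\<close> and a tiling of the remaining \<open>n - (p + k)\<close> labels with a
  long first brick.\<close>

lemma sum_falling:
  assumes "p + k \<le> s"
  shows "(\<Sum>Bs\<in>falling n p. tiling_weight Bs) =
    - yvar * (of_nat ((n - (p + 2)) choose (k - 1)) * long_sum (n - (p + k)))"
proof -
  let ?X = "{X. X \<subseteq> {p + 3..n} \<and> card X = k - 1}"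
  let ?C = "\<lambda>X. {Cs. Cs \<in> tilings ({p + 2..n} - X) \<and> starts_long Cs}"
  have finX: "finite ?X"
    by (rule finite_subset[of _ "Pow {p + 3..n}"]) auto
  have drop: "set (drop (p + 1) ([1..<p + 2] @ sorted_list_of_set X)) = X" if "X \<in> ?X" for X
    using that finite_subset[of X "{p + 3..n}"] by (simp del: upt_Suc)
  have "(\<Sum>Bs\<in>falling n p. tiling_weight Bs) =
      (\<Sum>(X, Cs)\<in>Sigma ?X ?C. - yvar * tiling_weight Cs)"
  proof (rule sum.reindex_bij_witness
      [where j = "\<lambda>Bs. (set (drop (p + 1) (hd Bs)), tl Bs)"
        and i = "\<lambda>(X, Cs). ([1..<p + 2] @ sorted_list_of_set X) # Cs"])
    fix Bs assume "Bs \<in> falling n p"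
    then obtain X Cs where *: "Bs = ([1..<p + 2] @ sorted_list_of_set X) # Cs"
      "X \<subseteq> {p + 3..n}" "card X = k - 1" "Cs \<in> tilings ({p + 2..n} - X)" "starts_long Cs"
      by (rule falling_decompose)
    then have X: "set (drop (p + 1) (hd Bs)) = X" "tl Bs = Cs"
      using drop[of X] by (simp_all del: upt_Suc drop_append)
    show "(case (set (drop (p + 1) (hd Bs)), tl Bs) of
        (X, Cs) \<Rightarrow> ([1..<p + 2] @ sorted_list_of_set X) # Cs) = Bs"
      unfolding X using *(1) by simp
    show "(set (drop (p + 1) (hd Bs)), tl Bs) \<in> Sigma ?X ?C"
      unfolding X using * by simp
    show "(case (set (drop (p + 1) (hd Bs)), tl Bs) of (X, Cs) \<Rightarrow> - yvar * tiling_weight Cs) =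
        tiling_weight Bs"
      unfolding X using *(1) by (simp add: tiling_weight_def)
  next
    fix c assume "c \<in> Sigma ?X ?C"
    then obtain X Cs where c: "c = (X, Cs)" "X \<in> ?X" "Cs \<in> ?C X"
      by blast
    show "(case c of (X, Cs) \<Rightarrow> ([1..<p + 2] @ sorted_list_of_set X) # Cs) \<in> falling n p"
      using c falling_compose[OF assms, of X n Cs] by simp
    show "(set (drop (p + 1) (hd (case c of (X, Cs) \<Rightarrow> ([1..<p + 2] @ sorted_list_of_set X) # Cs))),
        tl (case c of (X, Cs) \<Rightarrow> ([1..<p + 2] @ sorted_list_of_set X) # Cs)) = c"
      using c drop[of X] by (simp del: upt_Suc drop_append)
  qed
  also have "\<dots> = (\<Sum>X\<in>?X. \<Sum>Cs\<in>?C X. - yvar * tiling_weight Cs)"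
    by (rule sum.Sigma[symmetric]) (use finX in auto)
  also have "\<dots> = (\<Sum>X\<in>?X. - yvar * long_sum (n - (p + k)))"
  proof (rule sum.cong)
    fix X assume "X \<in> ?X"
    then have X: "X \<subseteq> {p + 2..n}" "card X = k - 1"
      by auto
    have "card ({p + 2..n} - X) = (n + 1 - (p + 2)) - (k - 1)"
      using X card_Diff_subset[of X "{p + 2..n}"] finite_subset[OF X(1)] by simp
    also have "\<dots> = n - (p + k)"
      using k_ge_2 by simp
    finally have "(\<Sum>Cs\<in>?C X. tiling_weight Cs) = long_sum (n - (p + k))"
      using sum_starts_long[of "{p + 2..n} - X"] by simp
    then show "(\<Sum>Cs\<in>?C X. - yvar * tiling_weight Cs) = - yvar * long_sum (n - (p + k))"
      by (simp only: sum_distrib_left[symmetric])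
  qed simp
  also have "\<dots> = of_nat (card ?X) * (- yvar * long_sum (n - (p + k)))"
    by simp
  also have "card ?X = (n - (p + 2)) choose (k - 1)"
    by (subst n_subsets) (simp_all add: numeral_3_eq_3)
  finally show ?thesis
    by (simp add: mult.left_commute)
qed

section \<open>Assembling the recursion\<close>

lemma length_hd_tiling:
  assumes "Bs \<in> tilings S" "Bs \<noteq> []"
  shows "1 \<le> length (hd Bs)" "length (hd Bs) \<le> s"
proof -
  have "brick (hd Bs)"
    using assms by (auto simp: tilings_def admissible_def)
  then show "1 \<le> length (hd Bs)" "length (hd Bs) \<le> s"
    by (auto simp: brick_def Suc_le_eq)
qed

text \<open>Without an ascent the link must be a match, whose half \<open>w1\<close> takes
  \<open>k\<close> entries of the first brick.\<close>

lemma rising_or_long: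
  assumes "Bs \<in> tilings S" "Bs \<noteq> []" "\<not> rising Bs"
  shows "k \<le> length (hd Bs)"
proof -
  obtain B Cs where Bs: "Bs = B # Cs"
    using assms by (auto simp: neq_Nil_conv)
  then have "linked B (hd Cs)" "\<not> last B < hd (hd Cs)"
    using assms by (auto simp: tilings_def admissible_Cons rising_def)
  then show ?thesis
    using Bs by (auto simp: linked_def matched_def)
qed

lemma Nil_notin_tilings: "n \<ge> 1 \<Longrightarrow> [] \<notin> tilings {1..n}"
  by (auto simp: tilings_def)

lemma sum_rising_range:
  assumes "R \<subseteq> {1..s}"
  shows "(\<Sum>Bs | Bs \<in> tilings {1..n} \<and> Bs \<noteq> [] \<and> rising Bs \<and> length (hd Bs) \<in> R.
    tiling_weight Bs) = - yvar * (\<Sum>r\<in>R. u (int n - int r))" (is "sum _ ?T = _")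
proof -
  have "sum tiling_weight ?T = (\<Sum>r\<in>R. \<Sum>Bs | Bs \<in> ?T \<and> length (hd Bs) = r. tiling_weight Bs)"
    using assms by (intro sum.group[symmetric]) (auto intro: finite_subset)
  also have "\<dots> = (\<Sum>r\<in>R. - yvar * u (int n - int r))"
  proof (rule sum.cong)
    fix r assume r: "r \<in> R"
    then have "{Bs. Bs \<in> ?T \<and> length (hd Bs) = r} =
        {Bs. Bs \<in> tilings {1..n} \<and> Bs \<noteq> [] \<and> rising Bs \<and> length (hd Bs) = r}"
      by auto
    then show "(\<Sum>Bs | Bs \<in> ?T \<and> length (hd Bs) = r. tiling_weight Bs) =
        - yvar * u (int n - int r)"
      using r assms sum_rising_tilings[of r n] by auto
  qed simp
  finally show ?thesis
    by (simp only: sum_distrib_left)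
qed

lemma long_sum_eq:
  assumes "n \<ge> 1"
  shows "long_sum n = u (int n) + yvar * (\<Sum>a = 1..k - 1. u (int n - int a))"
proof -
  let ?S = "{Bs. Bs \<in> tilings {1..n} \<and> Bs \<noteq> [] \<and> rising Bs \<and> length (hd Bs) \<in> {1..k - 1}}"
  let ?L = "{Bs. Bs \<in> tilings {1..n} \<and> starts_long Bs}"
  \<comment> \<open>The empty tiling would lie in neither part; \<open>n \<ge> 1\<close> excludes
    it.\<close>
  have split: "tilings {1..n} = ?S \<union> ?L"
    using rising_or_long[of _ "{1..n}"] length_hd_tiling[of _ "{1..n}"] Nil_notin_tilings[OF assms]
    by (fastforce simp: starts_long_def)
  have "?S \<inter> ?L = {}"
    using k_ge_2 by (auto simp: starts_long_def)
  then have "tiling_sum n = sum tiling_weight ?S + sum tiling_weight ?L"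
    unfolding tiling_sum_def by (subst split, intro sum.union_disjoint) simp_all
  also have "sum tiling_weight ?S = - yvar * (\<Sum>a = 1..k - 1. u (int n - int a))"
    using k_le_s by (intro sum_rising_range) auto
  finally show ?thesis
    using U_Gamma3_eq[of "int n"] by (simp add: long_sum_def)
qed

text \<open>Split by \<open>rising\<close>: a falling first brick has length \<open>p + k\<close>,
  at most \<open>s\<close>, and \<open>long_sum_eq\<close> expands what follows it. The formula also
  covers \<open>n = 1\<close>.\<close>

lemma U_recursion:
  assumes "n \<ge> 1"
  shows "u (int n) = - yvar * (\<Sum>r = 1..s. u (int n - int r)) -
    yvar * (\<Sum>p = 0..s - k. of_nat (nat (int n - int p - 2) choose (k - 1)) *
      (u (int n - int p - int k) + yvar * (\<Sum>a = 1..k - 1. u (int n - int p - int k - int a))))"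
proof -
  let ?R = "{Bs. Bs \<in> tilings {1..n} \<and> Bs \<noteq> [] \<and> rising Bs \<and> length (hd Bs) \<in> {1..s}}"
  let ?F = "\<Union>p\<in>{0..s - k}. falling n p"
  have split: "tilings {1..n} = ?R \<union> ?F"
  proof (intro equalityI subsetI)
    fix Bs assume Bs: "Bs \<in> tilings {1..n}"
    then have "Bs \<noteq> []"
      using Nil_notin_tilings[OF assms] by auto
    then have len: "1 \<le> length (hd Bs)" "length (hd Bs) \<le> s"
      using length_hd_tiling[OF Bs] by auto
    show "Bs \<in> ?R \<union> ?F"
    proof (cases "rising Bs")
      case True
      then show ?thesis using Bs \<open>Bs \<noteq> []\<close> len by simp
    next
      case False
      then have "k \<le> length (hd Bs)"
        using rising_or_long[OF Bs \<open>Bs \<noteq> []\<close>] by simp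
      then have "Bs \<in> falling n (length (hd Bs) - k)" "length (hd Bs) - k \<in> {0..s - k}"
        using False Bs \<open>Bs \<noteq> []\<close> len by (auto simp: falling_def)
      then show ?thesis by blast
    qed
  qed (auto simp: falling_def)
  have fin: "finite (falling n p)" for p
    by (simp add: falling_def)
  have "?R \<inter> ?F = {}"
    by (auto simp: falling_def)
  then have "tiling_sum n = sum tiling_weight ?R + sum tiling_weight ?F"
    unfolding tiling_sum_def by (subst split, intro sum.union_disjoint) (simp_all add: fin)
  also have "sum tiling_weight ?R = - yvar * (\<Sum>r = 1..s. u (int n - int r))"
    by (intro sum_rising_range) auto
  also have "sum tiling_weight ?F = (\<Sum>p = 0..s - k. sum tiling_weight (falling n p))"
    using fin by (intro sum.UNION_disjoint) (auto simp: falling_def)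
  also have "\<dots> = (\<Sum>p = 0..s - k. - yvar *
      (of_nat (nat (int n - int p - 2) choose (k - 1)) *
      (u (int n - int p - int k) + yvar * (\<Sum>a = 1..k - 1. u (int n - int p - int k - int a)))))"
  proof (rule sum.cong)
    fix p assume p: "p \<in> {0..s - k}"
    have eq: "nat (int n - int p - 2) = n - (p + 2)"
      by linarith
    show "sum tiling_weight (falling n p) = - yvar *
      (of_nat (nat (int n - int p - 2) choose (k - 1)) *
      (u (int n - int p - int k) + yvar * (\<Sum>a = 1..k - 1. u (int n - int p - int k - int a))))"
    proof (cases "n - (p + k) \<ge> 1")
      case True
      then have "int (n - (p + k)) = int n - int p - int k"
        by linarith
      then show ?thesis
        using sum_falling[of p n] long_sum_eq[OF True] p k_le_s unfolding eq by simp
    next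
      case False
      \<comment> \<open>For \<open>n = p + k\<close> the bracket is 1 although
        \<open>long_sum 0\<close> is 0; the coefficient vanishes because fewer than
        \<open>k - 1\<close> labels exceed \<open>p + 2\<close>.\<close>
      then have "(n - (p + 2)) choose (k - 1) = 0"
        using k_ge_2 by (intro binomial_eq_0) linarith
      then show ?thesis
        using sum_falling[of p n] p k_le_s unfolding eq by simp
    qed
  qed simp
  finally show ?thesis
    using U_Gamma3_eq[of "int n"] by (simp add: sum_distrib_left sum_negf)
qed

end

theorem theorem4:
  fixes k1 s :: nat and \<Gamma> :: "nat list set"
  assumes "2 \<le> k1" and "k1 \<le> s"
    and "\<Gamma> = Gamma3 k1 k1 s"
  shows "U \<Gamma> 1 = - yvar \<and>
    (\<forall>n::nat. n \<ge> 2 \<longrightarrow>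
      U \<Gamma> (int n) =
        - yvar * (\<Sum>r = 1..k1 - 1. U \<Gamma> (int n - int r))
        - yvar * (\<Sum>p = 0..s - k1.
            (1 + of_nat (nat (int n - int p - 2) choose (k1 - 1))) * U \<Gamma> (int n - int p - int k1)
            + yvar * of_nat (nat (int n - int p - 2) choose (k1 - 1))
                * (\<Sum>a = 1..k1 - 1. U \<Gamma> (int n - int p - int k1 - int a))))"
proof -
  interpret brick_params k1 s
    using assms by unfold_locales
  \<comment> \<open>Only \<open>r = 1\<close> meets a nonnegative index, where the value is
    1.\<close>
  have "(\<Sum>r = 1..s. U \<Gamma> (1 - int r)) = (\<Sum>r = 1..s. if r = 1 then 1 else 0)"
    by (intro sum.cong) (auto simp: assms(3) U_Gamma3_eq)
  also have "\<dots> = 1"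
    using assms by (subst sum.delta) auto
  finally have "U \<Gamma> 1 = - yvar"
    using U_recursion[of 1] assms by (simp add: binomial_eq_0)
  moreover have "U \<Gamma> (int n) =
        - yvar * (\<Sum>r = 1..k1 - 1. U \<Gamma> (int n - int r))
        - yvar * (\<Sum>p = 0..s - k1.
            (1 + of_nat (nat (int n - int p - 2) choose (k1 - 1))) * U \<Gamma> (int n - int p - int k1)
            + yvar * of_nat (nat (int n - int p - 2) choose (k1 - 1))
                * (\<Sum>a = 1..k1 - 1. U \<Gamma> (int n - int p - int k1 - int a)))"
    if "n \<ge> 2" for n :: nat
  proof -
    \<comment> \<open>Substituting \<open>r = p + k1\<close> for the lengths from \<open>k1\<close>
      on turns their terms into the summand 1 beside the binomial coefficient.\<close>
    have "{1..s} = {1..k1 - 1} \<union> {k1..s}" "{1..k1 - 1} \<inter> {k1..s} = {}"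
      using assms by auto
    then have "(\<Sum>r = 1..s. U \<Gamma> (int n - int r)) =
        (\<Sum>r = 1..k1 - 1. U \<Gamma> (int n - int r)) + (\<Sum>r = k1..s. U \<Gamma> (int n - int r))"
      by (simp add: sum.union_disjoint)
    also have "(\<Sum>r = k1..s. U \<Gamma> (int n - int r)) = (\<Sum>p = 0..s - k1. U \<Gamma> (int n - int p - int k1))"
      by (rule sum.reindex_bij_witness[where i = "\<lambda>p. p + k1" and j = "\<lambda>r. r - k1"])
        (use assms in \<open>auto simp: of_nat_diff\<close>)
    finally show ?thesis
      using U_recursion[of n] that assms(3)
      by (simp add: sum.distrib algebra_simps)
  qed
  ultimately show ?thesis
    by blast
qed

end
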